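(* Let $m\in K[x_1,\dots,x_n]$ be a squarefree monomial whose support (set of variables occurring in it) has size $k$. Then $I_{((k),\,n-k)}\subset I$ for every $G(r,1,n)$-invariant ideal $I\subset K[x_1,\dots,x_n]$ with $m\in I$.
   Context: Standing assumptions: $r\ge 2$, and $K$ is an infinite field containing all $r$-th roots of unity (e.g. algebraically closed). $\mu_r\subset K^\times$ is the group of $r$-th roots of unity, and $$G(r,1,n)=(\mathbb{Z}/r\mathbb{Z})\wr S_n=\{(\eta_1,\dots,\eta_n;\sigma):\eta_i\in\mu_r,\ \sigma\in S_n\}$$ acts on $K[x_1,\dots,x_n]$ by $(\eta;\sigma)\cdot f(x_1,\dots,x_n)=f(\eta_{\sigma(1)}x_{\sigma(1)},\dots,\eta_{\sigma(n)}x_{\sigma(n)})$. $(k)$ is the one-part partition of $k$ (the empty partition if $k=0$); $I_{((k),n-k)}$ is the case $\mu=(k)$, $z=n-k$ of the following definition. Classical Specht ideal: for a partition $\mu\vdash N$, $I_\mu\subset K[y_1,\dots,y_N]$ is the ideal generated by the Specht polynomials of all tableaux $T$ of shape $\mu$ (bijective fillings with $1,\dots,N$); the Specht polynomial of $T$ is the product over the columns of $T$ of the Vandermonde products $\prod(y_a-y_b)$ over pairs of entries $a,b$ in that column (one factor for each pair; empty products equal $1$). Definition of $I_{(\mu,z)}$: let $0\le z\le n$ and $\mu\vdash n-z$. For $S=\{i_1<\dots<i_{n-z}\}\subset\{1,\dots,n\}$, let $\phi_S:K[y_1,\dots,y_{n-z}]\to K[x_{i_1},\dots,x_{i_{n-z}}]$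 be the $K$-algebra homomorphism $y_j\mapsto x_{i_j}^r$, and let $X_S=(x_j:j\notin S)\subset K[x_1,\dots,x_n]$. Let $I_{\ge z+1}$ be the ideal of $K[x_1,\dots,x_n]$ generated by all squarefree monomials of degree $n-z$. Then $$I_{(\mu,z)}:=\Big[\bigcap_{S\subset\{1,\dots,n\},\,|S|=n-z}\big(X_S+\phi_S(I_\mu)\big)\Big]\cap I_{\ge z+1},$$ where $X_S+\phi_S(I_\mu)$ denotes the ideal of $K[x_1,\dots,x_n]$ generated by $X_S$ and $\phi_S(I_\mu)$. *)

theory Defs
  imports
    "HOL-Library.Poly_Mapping"
    "HOL-Library.FuncSet"
    "HOL-Combinatorics.Permutations"
    "HOL-Algebra.Ideal"
    "HOL-Algebra.Algebraic_Closure_Type"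
begin

text \<open>
  Polynomials over \<open>K\<close> in countably many variables \<open>x\<^sub>0, x\<^sub>1, x\<^sub>2, \<dots>\<close>: finitely supported functions
  from exponent vectors to coefficients. The ring \<open>K[x\<^sub>1, \<dots>, x\<^sub>n]\<close> is \<open>mpoly_ring {1..n}\<close> below; the
  variables \<open>y\<^sub>1, \<dots>, y\<^sub>N\<close> of classical Specht polynomials are the variables \<open>1, \<dots>, N\<close> of
  \<open>mpoly_ring {1..N}\<close>.
\<close>

type_synonym 'a mpoly = "(nat \<Rightarrow>\<^sub>0 nat) \<Rightarrow>\<^sub>0 'a"

definition const :: "'a \<Rightarrow> 'a::comm_ring_1 mpoly"
  where "const c = Poly_Mapping.single 0 c"

definition monomial :: "(nat \<Rightarrow>\<^sub>0 nat) \<Rightarrow> 'a::comm_ring_1 mpoly"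
  where "monomial e = Poly_Mapping.single e 1"

definition indet :: "nat \<Rightarrow> 'a::comm_ring_1 mpoly"
  where "indet i = monomial (Poly_Mapping.single i 1)"

definition mpoly_ring :: "nat set \<Rightarrow> 'a::comm_ring_1 mpoly ring" where
  "mpoly_ring A =
     \<lparr>carrier = {f. \<forall>e \<in> Poly_Mapping.keys f. Poly_Mapping.keys e \<subseteq> A},
      monoid.mult = (*), one = 1, zero = 0, add = (+)\<rparr>"

lemma mpoly_ring_cring: "cring (mpoly_ring A :: 'a::comm_ring_1 mpoly ring)"
proof -
  define C where "C = (carrier (mpoly_ring A) :: 'a mpoly set)"
  have C: "f \<in> C \<longleftrightarrow> (\<forall>e \<in> Poly_Mapping.keys f. Poly_Mapping.keys e \<subseteq> A)" for f :: "'a mpoly"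
    by (simp add: C_def mpoly_ring_def)
  have add: "f + g \<in> C" if "f \<in> C" "g \<in> C" for f g
    using that Poly_Mapping.keys_add[of f g] unfolding C by blast
  have mult: "f * g \<in> C" if f: "f \<in> C" and g: "g \<in> C" for f g
    unfolding C
  proof
    fix e assume "e \<in> Poly_Mapping.keys (f * g)"
    then obtain a b where "e = a + b" "a \<in> Poly_Mapping.keys f" "b \<in> Poly_Mapping.keys g"
      using Poly_Mapping.keys_mult[of f g] by blast
    moreover from this have "Poly_Mapping.keys a \<subseteq> A" "Poly_Mapping.keys b \<subseteq> A"
      using f g unfolding C by blast+
    ultimately show "Poly_Mapping.keys e \<subseteq> A"
      using Poly_Mapping.keys_add[of a b] by blast
  qed
  have minus: "- f \<in> C" if "f \<in> C" for f
    using that unfolding C by (simp add: in_keys_iff)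
  have [simp]: "0 \<in> C" "1 \<in> C"
    by (simp_all add: C)
  have R: "mpoly_ring A = \<lparr>carrier = C, monoid.mult = (*), one = 1, zero = 0, add = (+)\<rparr>"
    by (simp add: C_def mpoly_ring_def)
  show ?thesis
  proof (rule cringI)
    show "abelian_group (mpoly_ring A :: 'a mpoly ring)"
    proof (rule abelian_groupI)
      fix f :: "'a mpoly" assume "f \<in> carrier (mpoly_ring A)"
      then show "\<exists>g \<in> carrier (mpoly_ring A). g \<oplus>\<^bsub>mpoly_ring A\<^esub> f = \<zero>\<^bsub>mpoly_ring A\<^esub>"
        using minus[of f] by (intro bexI[of _ "- f"]) (simp_all add: R)
    qed (simp_all add: R add add.assoc add.commute)
    show "comm_monoid (mpoly_ring A :: 'a mpoly ring)"
      by (rule comm_monoidI) (simp_all add: R mult mult.assoc mult.commute)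
  qed (simp add: R distrib_right)
qed

text \<open>The \<open>K\<close>-algebra homomorphism that sends each variable \<open>x\<^sub>i\<close> to \<open>g i\<close>:\<close>

definition psubst :: "(nat \<Rightarrow> 'a::comm_ring_1 mpoly) \<Rightarrow> 'a mpoly \<Rightarrow> 'a mpoly" where
  "psubst g f =
     (\<Sum>e \<in> Poly_Mapping.keys f. const (Poly_Mapping.lookup f e) *
        (\<Prod>i \<in> Poly_Mapping.keys e. g i ^ Poly_Mapping.lookup e i))"

definition squarefree_exponent :: "(nat \<Rightarrow>\<^sub>0 nat) \<Rightarrow> bool"
  where "squarefree_exponent e \<longleftrightarrow> (\<forall>i. Poly_Mapping.lookup e i \<le> 1)"

definition total_degree :: "(nat \<Rightarrow>\<^sub>0 nat) \<Rightarrow> nat"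
  where "total_degree e = (\<Sum>i \<in> Poly_Mapping.keys e. Poly_Mapping.lookup e i)"

text \<open>
  \<open>K\<close> contains all \<open>r\<close>-th roots of unity of its algebraic closure. If the characteristic of \<open>K\<close>
  divides \<open>r\<close>, there are fewer than \<open>r\<close> of them.
\<close>

definition contains_roots_of_unity :: "'a::field itself \<Rightarrow> nat \<Rightarrow> bool" where
  "contains_roots_of_unity _ r \<longleftrightarrow>
     (\<forall>z :: 'a alg_closure. z ^ r = 1 \<longrightarrow> z \<in> range to_ac)"

definition roots_of_unity :: "nat \<Rightarrow> 'a::field set"
  where "roots_of_unity r = {a. a ^ r = 1}"

definition G :: "nat \<Rightarrow> nat \<Rightarrow> ((nat \<Rightarrow> 'a::field) \<times> (nat \<Rightarrow> nat)) set"
  where "G r n = ({1..n} \<rightarrow>\<^sub>E roots_of_unity r) \<times> {\<sigma>. \<sigma> permutes {1..n}}"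

definition act :: "(nat \<Rightarrow> 'a::field) \<times> (nat \<Rightarrow> nat) \<Rightarrow> 'a mpoly \<Rightarrow> 'a mpoly"
  where "act = (\<lambda>(\<eta>, \<sigma>). psubst (\<lambda>i. const (\<eta> (\<sigma> i)) * indet (\<sigma> i)))"

definition invariant_ideal :: "nat \<Rightarrow> nat \<Rightarrow> 'a::field mpoly set \<Rightarrow> bool" where
  "invariant_ideal r n I \<longleftrightarrow>
     ideal I (mpoly_ring {1..n}) \<and> (\<forall>g \<in> G r n. \<forall>f \<in> I. act g f \<in> I)"

text \<open>Partitions are weakly decreasing lists of positive parts; rows and columns count from 0.\<close>

definition is_partition :: "nat list \<Rightarrow> nat \<Rightarrow> bool"
  where "is_partition \<mu> N \<longleftrightarrow> sorted_wrt (\<ge>) \<mu> \<and> 0 \<notin> set \<mu> \<and> sum_list \<mu> = N"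

definition one_part :: "nat \<Rightarrow> nat list"
  where "one_part k = (if k = 0 then [] else [k])"

lemma is_partition_one_part: "is_partition (one_part k) k"
  by (simp add: is_partition_def one_part_def)

definition young_diagram :: "nat list \<Rightarrow> (nat \<times> nat) set"
  where "young_diagram \<mu> = {(i, j). i < length \<mu> \<and> j < \<mu> ! i}"

definition tableau :: "nat list \<Rightarrow> (nat \<times> nat \<Rightarrow> nat) \<Rightarrow> bool"
  where "tableau \<mu> T \<longleftrightarrow> bij_betw T (young_diagram \<mu>) {1..sum_list \<mu>}"

text \<open>
  Within a column, each pair of entries contributes (upper entry) \<open>-\<close> (lower entry). Any other choice
  of signs gives the same ideal.
\<close>

definition specht_poly :: "nat list \<Rightarrow> (nat \<times> nat \<Rightarrow> nat) \<Rightarrow> 'a::field mpoly" where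
  "specht_poly \<mu> T =
     (\<Prod>j \<in> snd ` young_diagram \<mu>.
        \<Prod>(i, i') \<in> {(i, i'). i < i' \<and> (i, j) \<in> young_diagram \<mu> \<and> (i', j) \<in> young_diagram \<mu>}.
          indet (T (i, j)) - indet (T (i', j)))"

definition specht_ideal :: "nat list \<Rightarrow> 'a::field mpoly set" where
  "specht_ideal \<mu> = Idl\<^bsub>mpoly_ring {1..sum_list \<mu>}\<^esub> {specht_poly \<mu> T | T. tableau \<mu> T}"

text \<open>
  For \<open>S = {i\<^sub>1 < \<dots> < i\<^sub>N}\<close>, \<open>\<phi> r S\<close> sends \<open>y\<^sub>j\<close> to \<open>x\<^sub>i\<^sub>j ^ r\<close>. It is only meaningful on polynomials in
  \<open>y\<^sub>1, \<dots>, y\<^sub>N\<close>.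
\<close>

definition \<phi> :: "nat \<Rightarrow> nat set \<Rightarrow> 'a::field mpoly \<Rightarrow> 'a mpoly"
  where "\<phi> r S = psubst (\<lambda>j. indet (sorted_list_of_set S ! (j - 1)) ^ r)"

definition X_ideal :: "nat \<Rightarrow> nat set \<Rightarrow> 'a::field mpoly set"
  where "X_ideal n S = Idl\<^bsub>mpoly_ring {1..n}\<^esub> (indet ` ({1..n} - S))"

text \<open>\<open>I_ge n d\<close> is generated by the squarefree monomials of degree \<open>n + 1 - d\<close>; so \<open>d = z + 1\<close> below.\<close>

definition I_ge :: "nat \<Rightarrow> nat \<Rightarrow> 'a::field mpoly set" where
  "I_ge n d = Idl\<^bsub>mpoly_ring {1..n}\<^esub>
     {monomial e | e. Poly_Mapping.keys e \<subseteq> {1..n} \<and> squarefree_exponent e \<and>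
                      total_degree e = n + 1 - d}"

text \<open>The ideal \<open>I\<^bsub>(\<mu>,z)\<^esub>\<close>, for \<open>z \<le> n\<close> and a partition \<open>\<mu>\<close> of \<open>n - z\<close>:\<close>

definition I_specht :: "nat \<Rightarrow> nat \<Rightarrow> nat list \<Rightarrow> nat \<Rightarrow> 'a::field mpoly set" where
  "I_specht r n \<mu> z =
     (\<Inter>S \<in> {S. S \<subseteq> {1..n} \<and> card S = n - z}.
        Idl\<^bsub>mpoly_ring {1..n}\<^esub> (X_ideal n S \<union> \<phi> r S ` specht_ideal \<mu>))
     \<inter> I_ge n (z + 1)"

end

theory Submission
  imports Defs
begin

text \<open>
  By definition \<open>I_specht r n (one_part k) (n - k)\<close> is contained in the ideal generated by all squarefree
  monomials of degree \<open>k\<close>, and the permutations in \<open>G r n\<close> already act transitively on these monomials.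
\<close>

lemma monomial_0: "monomial 0 = 1"
  by (simp add: monomial_def)

lemma monomial_add: "monomial (a + b) = monomial a * monomial b"
  by (simp add: monomial_def mult_single)

lemma monomial_sum:
  "finite A \<Longrightarrow> monomial (\<Sum>i\<in>A. f i) = (\<Prod>i\<in>A. monomial (f i))"
  by (induction A rule: finite_induct) (simp_all add: monomial_0 monomial_add)

lemma squarefree_exponent_lookup:
  assumes "squarefree_exponent e" "i \<in> Poly_Mapping.keys e"
  shows "Poly_Mapping.lookup e i = 1"
  using assms by (metis in_keys_iff le_antisym less_one not_le squarefree_exponent_def)

text \<open>A 0/1 exponent vector is the sum of the unit vectors over its support, and
  \<open>monomial\<close> turns sums into products. Hence such a monomial is determined by its
  support.\<close>

lemma monomial_squarefree_exponent:
  assumes "squarefree_exponent e"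
  shows "monomial e = (\<Prod>i\<in>Poly_Mapping.keys e. indet i)"
proof -
  have "e = (\<Sum>i\<in>Poly_Mapping.keys e. Poly_Mapping.single i 1)"
  proof (rule poly_mapping_eqI)
    fix j
    show "Poly_Mapping.lookup e j
        = Poly_Mapping.lookup (\<Sum>i\<in>Poly_Mapping.keys e. Poly_Mapping.single i 1) j"
      using squarefree_exponent_lookup[OF assms, of j]
      by (auto simp: lookup_sum lookup_single when_def in_keys_iff)
  qed
  then show ?thesis
    by (metis (mono_tags, lifting) finite_keys indet_def monomial_sum prod.cong)
qed

lemma total_degree_squarefree_exponent:
  assumes "squarefree_exponent e"
  shows "total_degree e = card (Poly_Mapping.keys e)"
  by (simp add: total_degree_def squarefree_exponent_lookup[OF assms])

lemma psubst_monomial_squarefree_exponent: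
  assumes "squarefree_exponent e"
  shows "psubst g (monomial e) = (\<Prod>i\<in>Poly_Mapping.keys e. g i)"
  by (simp add: psubst_def monomial_def const_def squarefree_exponent_lookup[OF assms])

text \<open>With every root of unity equal to 1, the group element only renames variables, so the
  action on squarefree monomials becomes the action of \<open>\<sigma>\<close> on supports.\<close>

lemma act_permutation_monomial:
  assumes \<sigma>: "\<sigma> permutes {1..n}"
    and e: "squarefree_exponent e" "Poly_Mapping.keys e \<subseteq> {1..n}"
    and e': "squarefree_exponent e'" "Poly_Mapping.keys e' = \<sigma> ` Poly_Mapping.keys e"
  shows "act (\<lambda>i\<in>{1..n}. 1, \<sigma>) (monomial e) = monomial e'"
proof -
  have "act (\<lambda>i\<in>{1..n}. 1, \<sigma>) (monomial e) = (\<Prod>i\<in>Poly_Mapping.keys e. indet (\<sigma> i))"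
    unfolding act_def split psubst_monomial_squarefree_exponent[OF e(1)]
  proof (rule prod.cong)
    fix i assume "i \<in> Poly_Mapping.keys e"
    \<comment> \<open>The restricted constant function has the value 1 only on
      \<open>{1..n}\<close>, so its argument \<open>\<sigma> i\<close> must be shown to lie
      there.\<close>
    then have "\<sigma> i \<in> {1..n}"
      using e(2) permutes_in_image[OF \<sigma>] by blast
    then show "const ((\<lambda>i\<in>{1..n}. 1) (\<sigma> i)) * indet (\<sigma> i) = indet (\<sigma> i)"
      by (simp add: const_def)
  qed simp
  also have "\<dots> = (\<Prod>j\<in>\<sigma> ` Poly_Mapping.keys e. indet j)"
    using permutes_inj_on[OF \<sigma>] by (simp add: prod.reindex)
  also have "\<dots> = monomial e'"
    by (simp add: monomial_squarefree_exponent[OF e'(1)] e'(2))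
  finally show ?thesis .
qed

text \<open>Transitivity of the symmetric group on subsets of a fixed size: a bijection from
  \<open>A\<close> to \<open>B\<close> is glued to one between the complements, which are again
  equinumerous.\<close>

lemma ex_permutes_image_eq:
  assumes "finite N" "A \<subseteq> N" "B \<subseteq> N" "card A = card B"
  obtains \<sigma> where "\<sigma> permutes N" "\<sigma> ` A = B"
proof -
  have fin: "finite A" "finite B"
    using assms finite_subset by blast+
  obtain f where f: "bij_betw f A B"
    using fin assms(4) finite_same_card_bij by blast
  have "card (N - A) = card (N - B)"
    using assms fin by (simp add: card_Diff_subset)
  then obtain g where g: "bij_betw g (N - A) (N - B)"
    using assms(1) finite_same_card_bij[of "N - A" "N - B"] by blast
  \<comment> \<open>The last branch fixes every point outside \<open>N\<close>, as
    \<open>permutes\<close> demands.\<close>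
  define \<sigma> where "\<sigma> x = (if x \<in> A then f x else if x \<in> N then g x else x)" for x
  have A: "bij_betw \<sigma> A B"
    using f by (simp add: \<sigma>_def cong: bij_betw_cong)
  have "bij_betw \<sigma> (N - A) (N - B)"
    using g by (subst bij_betw_cong[of _ _ g]) (auto simp: \<sigma>_def)
  from bij_betw_combine[OF A this] have "bij_betw \<sigma> N N"
    using assms(2,3) by (simp add: Un_absorb1)
  then have "\<sigma> permutes N"
    using assms(2) by (intro bij_imp_permutes) (auto simp: \<sigma>_def)
  with A show thesis
    using that by (simp add: bij_betw_def)
qed

lemma monomial_mem_invariant_ideal:
  fixes I :: "'a::field mpoly set"
  assumes I: "invariant_ideal r n I" "monomial e \<in> I"
    and e: "squarefree_exponent e" "Poly_Mapping.keys e \<subseteq> {1..n}"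
    and e': "squarefree_exponent e'" "Poly_Mapping.keys e' \<subseteq> {1..n}"
    and card: "card (Poly_Mapping.keys e) = card (Poly_Mapping.keys e')"
  shows "monomial e' \<in> I"
proof -
  obtain \<sigma> where \<sigma>: "\<sigma> permutes {1..n}" "\<sigma> ` Poly_Mapping.keys e = Poly_Mapping.keys e'"
    using ex_permutes_image_eq[OF _ e(2) e'(2) card] by blast
  \<comment> \<open>1 is an \<open>r\<close>-th root of unity, and restricting the constant function
    to \<open>{1..n}\<close> makes it extensional, as the function space in \<open>G\<close>
    requires.\<close>
  have "(\<lambda>i\<in>{1..n}. 1, \<sigma>) \<in> (G r n :: ((nat \<Rightarrow> 'a) \<times> _) set)"
    using \<sigma>(1) by (simp add: G_def roots_of_unity_def)
  then have "act (\<lambda>i\<in>{1..n}. 1, \<sigma>) (monomial e) \<in> I"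
    using I unfolding invariant_ideal_def by blast
  then show ?thesis
    using act_permutation_monomial[OF \<sigma>(1) e e'(1) \<sigma>(2)[symmetric]] by metis
qed

theorem proposition5p1:
  fixes r n k :: nat
    and e :: "nat \<Rightarrow>\<^sub>0 nat"
    and m :: "'a::field mpoly"
    and I :: "'a mpoly set"
  assumes "r \<ge> 2"
    and "infinite (UNIV :: 'a set)"
    and "contains_roots_of_unity TYPE('a) r"
    and "m = monomial e"
    and "Poly_Mapping.keys e \<subseteq> {1..n}"
    and "squarefree_exponent e"
    and "card (Poly_Mapping.keys e) = k"
    and "invariant_ideal r n I"
    and "m \<in> I"
  shows "I_specht r n (one_part k) (n - k) \<subseteq> I"
proof -
  interpret cring "mpoly_ring {1..n} :: 'a mpoly ring"
    by (rule mpoly_ring_cring)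
  \<comment> \<open>Subtraction on naturals truncates; this bound is what makes the degree of the
    generators of \<open>I_ge n (n - k + 1)\<close> exactly \<open>k\<close>.\<close>
  have "k \<le> n"
    using card_mono[of "{1..n}" "Poly_Mapping.keys e"] assms(5,7) by simp
  then have deg: "n + 1 - (n - k + 1) = k"
    by simp
  have "I_ge n (n - k + 1) \<subseteq> I"
    unfolding I_ge_def deg
  proof (rule genideal_minimal)
    show "ideal I (mpoly_ring {1..n})"
      using assms(8) by (simp add: invariant_ideal_def)
    show "{monomial e' | e'. Poly_Mapping.keys e' \<subseteq> {1..n} \<and> squarefree_exponent e'
        \<and> total_degree e' = k} \<subseteq> I"
      \<comment> \<open>For a squarefree exponent, total degree \<open>k\<close> means support of
        size \<open>k\<close>, the same size as the support of \<open>e\<close>.\<close>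
      using monomial_mem_invariant_ideal[OF assms(8) _ assms(6,5)] assms(4,7,9)
      by (auto simp: total_degree_squarefree_exponent)
  qed
  then show ?thesis
    unfolding I_specht_def by blast
qed

end
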